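(* Let $(X_1,d_{X_1}),\dots,(X_n,d_{X_n})$ be metric spaces and let $P=X_1\times\cdots\times X_n$. The following conditions are equivalent for every metric $d$ on $P$. (i) $d$ is an isotone metric product with an isotone amenable continuation. (ii) $d$ is distance-increasing and the identical mapping $\mathrm{id}(x_1,\dots,x_n)=(x_1,\dots,x_n)$, $(x_1,\dots,x_n)\in P$, is bornologous as a mapping from $(P,\rho_\infty)$ to $(P,d)$ and uniformly continuous as a mapping from $(P,d)$ to $(P,\rho_\infty)$.
   Context: $\mathbb{R}_+=[0,\infty)$, $n\ge 1$, $\bar{0}=(0,\dots,0)$. For $\bar{x},\bar{y}\in\mathbb{R}^n_+$, $\bar{x}\leqslant\bar{y}$ means $x_i\leqslant y_i$ for every $i$. For $A\subseteq\mathbb{R}^n_+$, a function $f:A\to\mathbb{R}_+$ is isotone if $\bar{x}\leqslant\bar{y}$ implies $f(\bar{x})\leqslant f(\bar{y})$ for all $\bar{x},\bar{y}\in A$. If $\bar{0}\in A$, a function $f:A\to\mathbb{R}_+$ is amenable if $f(\bar{0})=0$ and $f(\bar{x})>0$ for every $\bar{x}\in A\setminus\{\bar{0}\}$. The distance set of a metric space $(X,d_X)$ is $D_X=\{d_X(x,y):x,y\in X\}$. A metric $d$ on $P$ is an isotone metric product if there is an isotone function $\Phi:D_{X_1}\times\cdots\times D_{X_n}\to\mathbb{R}_+$ such that $d((x_1,\dots,x_n),(y_1,\dots,y_n))=\Phi(d_{X_1}(x_1,y_1),\dots,d_{X_n}(x_n,y_n))$ for all $(x_1,\dots,x_n),(y_1,\dots,y_n)\in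 P$. It has an isotone amenable continuation if there is an isotone and amenable function $\Phi:\mathbb{R}^n_+\to\mathbb{R}_+$ for which the same equality holds for all points of $P$. A metric $d$ on $P$ is distance-increasing if $d((x_1,\dots,x_n),(y_1,\dots,y_n))\leqslant d((\tilde{x}_1,\dots,\tilde{x}_n),(\tilde{y}_1,\dots,\tilde{y}_n))$ whenever $(d_{X_1}(x_1,y_1),\dots,d_{X_n}(x_n,y_n))\leqslant(d_{X_1}(\tilde{x}_1,\tilde{y}_1),\dots,d_{X_n}(\tilde{x}_n,\tilde{y}_n))$. The metric $\rho_\infty$ on $P$ is $\rho_\infty((x_1,\dots,x_n),(y_1,\dots,y_n))=\max_{1\leqslant i\leqslant n}d_{X_i}(x_i,y_i)$. A mapping $f:(X,d)\to(Y,\rho)$ of metric spaces is bornologous if for every $\varepsilon\in\mathbb{R}_+$ there is $\delta\in\mathbb{R}_+$ such that $d(x,y)\leqslant\varepsilon$ implies $\rho(f(x),f(y))\leqslant\delta$ for all $x,y\in X$. *)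

theory Defs
  imports "HOL-Analysis.Analysis"
begin

text \<open>
  Points of $\mathbb{R}^n$ are of type \<^typ>\<open>real ^ 'n\<close>, whose library order is componentwise
  (\<open>less_eq_vec_def\<close>). The factors are a family \<open>X :: 'n \<Rightarrow> 'a metric\<close>; their carriers are
  arbitrary, possibly different subsets of \<open>'a\<close>, and this loses no generality because any
  finite family of metric spaces embeds isometrically into a common type (a disjoint sum).
  The index type is finite and nonempty, hence $n \ge 1$.
\<close>

definition nonneg_orthant :: "(real ^ 'n) set"
  where "nonneg_orthant = {v. \<forall>i. 0 \<le> v $ i}"

definition isotone_on :: "(real ^ 'n) set \<Rightarrow> (real ^ 'n \<Rightarrow> real) \<Rightarrow> bool"
  where "isotone_on A f \<longleftrightarrow> f \<in> A \<rightarrow> {0..} \<and> mono_on A f"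

definition amenable_on :: "(real ^ 'n) set \<Rightarrow> (real ^ 'n \<Rightarrow> real) \<Rightarrow> bool"
  where "amenable_on A f \<longleftrightarrow>
    0 \<in> A \<and> f \<in> A \<rightarrow> {0..} \<and> f 0 = 0 \<and> (\<forall>x \<in> A - {0}. 0 < f x)"

definition distance_set :: "'a metric \<Rightarrow> real set"
  where "distance_set m = {mdist m x y | x y. x \<in> mspace m \<and> y \<in> mspace m}"

definition product_space :: "('n \<Rightarrow> 'a metric) \<Rightarrow> ('n \<Rightarrow> 'a) set"
  where "product_space X = (\<Pi>\<^sub>E i\<in>UNIV. mspace (X i))"

definition distance_vector ::
    "('n::finite \<Rightarrow> 'a metric) \<Rightarrow> ('n \<Rightarrow> 'a) \<Rightarrow> ('n \<Rightarrow> 'a) \<Rightarrow> real ^ 'n"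
  where "distance_vector X x y = (\<chi> i. mdist (X i) (x i) (y i))"

text \<open>
  In the next three definitions \<open>D\<close> is meant to be a metric on the product, that is,
  \<open>mspace D = product_space X\<close>.
\<close>

definition isotone_metric_product ::
    "('n::finite \<Rightarrow> 'a metric) \<Rightarrow> ('n \<Rightarrow> 'a) metric \<Rightarrow> bool"
  where "isotone_metric_product X D \<longleftrightarrow>
    (\<exists>\<Phi>. isotone_on {v. \<forall>i. v $ i \<in> distance_set (X i)} \<Phi> \<and>
      (\<forall>x \<in> product_space X. \<forall>y \<in> product_space X. mdist D x y = \<Phi> (distance_vector X x y)))"

definition has_isotone_amenable_continuation ::
    "('n::finite \<Rightarrow> 'a metric) \<Rightarrow> ('n \<Rightarrow> 'a) metric \<Rightarrow> bool"
  where "has_isotone_amenable_continuation X D \<longleftrightarrow>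
    (\<exists>\<Phi>. isotone_on nonneg_orthant \<Phi> \<and> amenable_on nonneg_orthant \<Phi> \<and>
      (\<forall>x \<in> product_space X. \<forall>y \<in> product_space X. mdist D x y = \<Phi> (distance_vector X x y)))"

definition distance_increasing ::
    "('n::finite \<Rightarrow> 'a metric) \<Rightarrow> ('n \<Rightarrow> 'a) metric \<Rightarrow> bool"
  where "distance_increasing X D \<longleftrightarrow>
    (\<forall>x \<in> product_space X. \<forall>y \<in> product_space X.
     \<forall>x' \<in> product_space X. \<forall>y' \<in> product_space X.
       distance_vector X x y \<le> distance_vector X x' y' \<longrightarrow> mdist D x y \<le> mdist D x' y')"

definition max_dist ::
    "('n::finite \<Rightarrow> 'a metric) \<Rightarrow> ('n \<Rightarrow> 'a) \<Rightarrow> ('n \<Rightarrow> 'a) \<Rightarrow> real"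
  where "max_dist X x y = Max (range (\<lambda>i. mdist (X i) (x i) (y i)))"

lemma Metric_space_max_dist: "Metric_space (product_space X) (max_dist X)"
proof
  have ge: "mdist (X i) (x i) (y i) \<le> max_dist X x y" for i x y
    unfolding max_dist_def by (rule Max_ge) auto
  have le: "max_dist X x y \<le> c \<longleftrightarrow> (\<forall>i. mdist (X i) (x i) (y i) \<le> c)" for x y c
    unfolding max_dist_def by (subst Max_le_iff) auto
  show nn: "0 \<le> max_dist X x y" for x y
    using ge[of undefined x y] mdist_nonneg[of "X undefined" "x undefined" "y undefined"]
    by linarith
  show "max_dist X x y = max_dist X y x" for x y
    by (simp add: max_dist_def mdist_commute)
  show "max_dist X x y = 0 \<longleftrightarrow> x = y" if "x \<in> product_space X" "y \<in> product_space X" for x y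
  proof -
    have m: "x i \<in> mspace (X i)" "y i \<in> mspace (X i)" for i
      using that by (auto simp: product_space_def)
    have "max_dist X x y = 0 \<longleftrightarrow> (\<forall>i. mdist (X i) (x i) (y i) \<le> 0)"
      using le[of x y 0] nn[of x y] by (metis order_antisym order_refl)
    also have "\<dots> \<longleftrightarrow> (\<forall>i. x i = y i)"
      using m by (metis mdist_nonneg mdist_zero order_antisym order_refl)
    finally show ?thesis by auto
  qed
  show "max_dist X x z \<le> max_dist X x y + max_dist X y z"
    if "x \<in> product_space X" "y \<in> product_space X" "z \<in> product_space X" for x y z
    unfolding le
  proof
    fix i
    have "mdist (X i) (x i) (z i) \<le> mdist (X i) (x i) (y i) + mdist (X i) (y i) (z i)"
      using that by (intro mdist_triangle) (auto simp: product_space_def)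
    then show "mdist (X i) (x i) (z i) \<le> max_dist X x y + max_dist X y z"
      using ge[of i x y] ge[of i y z] by linarith
  qed
qed

definition max_metric :: "('n::finite \<Rightarrow> 'a metric) \<Rightarrow> ('n \<Rightarrow> 'a) metric"
  where "max_metric X = metric (product_space X, max_dist X)"

lemma mspace_max_metric [simp]: "mspace (max_metric X) = product_space X"
  by (simp add: max_metric_def Metric_space.mspace_metric Metric_space_max_dist)

lemma mdist_max_metric [simp]: "mdist (max_metric X) = max_dist X"
  by (simp add: max_metric_def Metric_space.mdist_metric Metric_space_max_dist)

text \<open>As in the definition, \<open>\<epsilon>\<close> and \<open>\<delta>\<close> range over $[0,\infty)$, zero included.\<close>

definition bornologous :: "'a metric \<Rightarrow> 'b metric \<Rightarrow> ('a \<Rightarrow> 'b) \<Rightarrow> bool"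
  where "bornologous m1 m2 f \<longleftrightarrow> f \<in> mspace m1 \<rightarrow> mspace m2 \<and>
    (\<forall>\<epsilon>\<ge>0. \<exists>\<delta>\<ge>0. \<forall>x \<in> mspace m1. \<forall>y \<in> mspace m1.
      mdist m1 x y \<le> \<epsilon> \<longrightarrow> mdist m2 (f x) (f y) \<le> \<delta>)"

end

theory Submission
  imports Defs
begin

text \<open>
  If \<open>\<Phi>\<close> is an isotone amenable continuation, then \<open>d \<le> \<Phi> (\<epsilon>, \<dots>, \<epsilon>)\<close> whenever
  \<open>\<rho>\<^sub>\<infinity> \<le> \<epsilon>\<close>, and \<open>d \<ge> min\<^sub>i \<Phi> (\<epsilon> e\<^sub>i) > 0\<close> whenever \<open>\<rho>\<^sub>\<infinity> \<ge> \<epsilon>\<close>.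
  Conversely, the supremum of \<open>d\<close> over all pairs whose distance vector lies below \<open>v\<close> is
  an isotone function of \<open>v\<close> that extends \<open>d\<close>; it is finite because the identity is
  bornologous, but it may vanish at \<open>v \<noteq> 0\<close>. The infimum of \<open>\<Sum>\<^sub>i v\<^sub>i\<close> and all values of \<open>d\<close>
  at pairs whose distance vector lies above \<open>v\<close> is isotone too, is at most \<open>d\<close> at distance
  vectors, and is positive at \<open>v \<noteq> 0\<close> by uniform continuity. The maximum of the two is the
  required continuation.
\<close>

lemma distance_vector_nth [simp]: "distance_vector X x y $ i = mdist (X i) (x i) (y i)"
  by (simp add: distance_vector_def)

lemma distance_vector_in_nonneg_orthant: "distance_vector X x y \<in> nonneg_orthant"
  by (simp add: nonneg_orthant_def)

lemma max_dist_le_iff: "max_dist X x y \<le> c \<longleftrightarrow> (\<forall>i. mdist (X i) (x i) (y i) \<le> c)"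
  unfolding max_dist_def by (subst Max_le_iff) auto

lemma max_dist_less_iff: "max_dist X x y < c \<longleftrightarrow> (\<forall>i. mdist (X i) (x i) (y i) < c)"
  unfolding max_dist_def by (subst Max_less_iff) auto

lemma distance_vector_self:
  assumes "x \<in> product_space X"
  shows "distance_vector X x x = 0"
  using assms by (simp add: vec_eq_iff product_space_def PiE_iff)

lemma distance_vector_le_0_imp_eq:
  assumes "x \<in> product_space X" "y \<in> product_space X" "distance_vector X x y \<le> 0"
  shows "x = y"
proof
  fix i
  have "x i \<in> mspace (X i)" "y i \<in> mspace (X i)"
    using assms by (auto simp: product_space_def)
  moreover have "mdist (X i) (x i) (y i) = 0"
    using assms(3) mdist_nonneg[of "X i" "x i" "y i"]
    by (auto simp: less_eq_vec_def intro: order_antisym)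
  ultimately show "x i = y i" by simp
qed

text \<open>Distance sets contain only nonnegative numbers, so their product lies in the orthant and
  \<Phi> can simply be restricted to it.\<close>

lemma isotone_metric_product_if_continuation:
  assumes "has_isotone_amenable_continuation X D"
  shows "isotone_metric_product X D"
proof -
  obtain \<Phi> where \<Phi>: "isotone_on nonneg_orthant \<Phi>"
    "\<forall>x \<in> product_space X. \<forall>y \<in> product_space X. mdist D x y = \<Phi> (distance_vector X x y)"
    using assms unfolding has_isotone_amenable_continuation_def by blast
  have "v \<in> nonneg_orthant" if "\<forall>i. v $ i \<in> distance_set (X i)" for v
  proof -
    have "0 \<le> v $ i" for i
      using that[rule_format, of i] by (auto simp: distance_set_def)
    then show ?thesis by (simp add: nonneg_orthant_def)
  qed
  then have "{v. \<forall>i. v $ i \<in> distance_set (X i)} \<subseteq> nonneg_orthant" by blast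
  then have "isotone_on {v. \<forall>i. v $ i \<in> distance_set (X i)} \<Phi>"
    using \<Phi>(1) unfolding isotone_on_def
    by (meson Pi_anti_mono mono_on_subset subsetD)
  with \<Phi>(2) show ?thesis unfolding isotone_metric_product_def by blast
qed

lemma continuation_imp_conditions:
  fixes X :: "'n::finite \<Rightarrow> 'a metric"
  assumes D: "mspace D = product_space X"
    and cont: "has_isotone_amenable_continuation X D"
  shows "distance_increasing X D" and "bornologous (max_metric X) D id"
    and "uniformly_continuous_map D (max_metric X) id"
proof -
  obtain \<Phi> where iso: "isotone_on nonneg_orthant \<Phi>"
    and am: "amenable_on nonneg_orthant \<Phi>"
    and eq: "\<And>x y. \<lbrakk>x \<in> product_space X; y \<in> product_space X\<rbrakk>
      \<Longrightarrow> mdist D x y = \<Phi> (distance_vector X x y)"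
    using cont unfolding has_isotone_amenable_continuation_def by blast
  have mono: "\<Phi> u \<le> \<Phi> v" if "u \<in> nonneg_orthant" "v \<in> nonneg_orthant" "u \<le> v" for u v
    using iso that unfolding isotone_on_def by (auto dest: mono_onD)
  show "distance_increasing X D"
    unfolding distance_increasing_def
    by (auto simp: eq intro!: mono distance_vector_in_nonneg_orthant)
  show "bornologous (max_metric X) D id"
    unfolding bornologous_def
  proof (intro conjI allI impI)
    fix \<epsilon> :: real assume "0 \<le> \<epsilon>"
    then have e: "(\<chi> i. \<epsilon>) \<in> nonneg_orthant" by (simp add: nonneg_orthant_def)
    show "\<exists>\<delta>\<ge>0. \<forall>x\<in>mspace (max_metric X). \<forall>y\<in>mspace (max_metric X).
        mdist (max_metric X) x y \<le> \<epsilon> \<longrightarrow> mdist D (id x) (id y) \<le> \<delta>"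
    proof (intro exI conjI ballI impI)
      show "0 \<le> \<Phi> (\<chi> i. \<epsilon>)" using iso e by (auto simp: isotone_on_def)
      show "mdist D (id x) (id y) \<le> \<Phi> (\<chi> i. \<epsilon>)"
        if "x \<in> mspace (max_metric X)" "y \<in> mspace (max_metric X)"
          "mdist (max_metric X) x y \<le> \<epsilon>" for x y
        using that
        by (auto simp: eq max_dist_le_iff less_eq_vec_def
            intro!: mono distance_vector_in_nonneg_orthant e)
    qed
  qed (simp add: D)
  show "uniformly_continuous_map D (max_metric X) id"
    unfolding uniformly_continuous_map_def
  proof (intro conjI allI impI)
    fix \<epsilon> :: real assume "0 < \<epsilon>"
    \<comment> \<open>\<open>axis i \<epsilon>\<close> is the least vector of the orthant whose
      coordinate \<open>i\<close> is at least \<epsilon>. The minimum of the positive values there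
      is positive because there are only finitely many indices.\<close>
    let ?\<delta> = "Min (range (\<lambda>i::'n. \<Phi> (axis i \<epsilon>)))"
    have ax: "axis i \<epsilon> \<in> nonneg_orthant" for i :: 'n
      using \<open>0 < \<epsilon>\<close> by (auto simp: nonneg_orthant_def axis_def)
    have "0 < \<Phi> (axis i \<epsilon>)" for i
      using am ax[of i] \<open>0 < \<epsilon>\<close> unfolding amenable_on_def by (auto simp: axis_eq_0_iff)
    then have "0 < ?\<delta>" by (subst Min_gr_iff) auto
    \<comment> \<open>The order of the arguments follows
      \<open>uniformly_continuous_map_def\<close>.\<close>
    moreover have "max_dist X y x < \<epsilon>"
      if xy: "x \<in> product_space X" "y \<in> product_space X" and less: "mdist D y x < ?\<delta>" for x y
    proof (rule ccontr)
      assume "\<not> max_dist X y x < \<epsilon>"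
      then obtain i where "\<epsilon> \<le> mdist (X i) (y i) (x i)"
        by (auto simp: max_dist_less_iff not_less)
      then have "axis i \<epsilon> \<le> distance_vector X y x"
        by (auto simp: less_eq_vec_def axis_def)
      then have "\<Phi> (axis i \<epsilon>) \<le> mdist D y x"
        using xy by (simp add: eq mono ax distance_vector_in_nonneg_orthant)
      moreover have "?\<delta> \<le> \<Phi> (axis i \<epsilon>)" by (rule Min_le) auto
      ultimately show False using less by simp
    qed
    ultimately show "\<exists>\<delta>>0. \<forall>x\<in>mspace D. \<forall>y\<in>mspace D.
        mdist D y x < \<delta> \<longrightarrow> mdist (max_metric X) (id y) (id x) < \<epsilon>"
      unfolding D mspace_max_metric mdist_max_metric id_apply by blast
  qed (simp add: D)
qed

lemma conditions_imp_continuation: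
  fixes X :: "'n::finite \<Rightarrow> 'a metric"
  assumes D: "mspace D = product_space X"
    and incr: "distance_increasing X D"
    and born: "bornologous (max_metric X) D id"
    and unif: "uniformly_continuous_map D (max_metric X) id"
  shows "has_isotone_amenable_continuation X D"
proof -
  let ?P = "product_space X"
  \<comment> \<open>The inserted 0 keeps the set nonempty even for an empty product and makes its
    supremum nonnegative on the orthant.\<close>
  define below where "below v = insert 0
    {mdist D x y | x y. x \<in> ?P \<and> y \<in> ?P \<and> distance_vector X x y \<le> v}" for v
  \<comment> \<open>Inserting the coordinate sum keeps the set nonempty and also covers the case that some
    factor is empty.\<close>
  define above where "above v = insert (\<Sum>i\<in>UNIV. v $ i)
    {mdist D x y | x y. x \<in> ?P \<and> y \<in> ?P \<and> v \<le> distance_vector X x y}" for v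
  define \<Phi> where "\<Phi> v = max (Sup (below v)) (Inf (above v))" for v
  have sum_nonneg: "0 \<le> (\<Sum>i\<in>UNIV. v $ i)" if "v \<in> nonneg_orthant" for v :: "real ^ 'n"
    using that by (auto simp: nonneg_orthant_def intro: sum_nonneg)
  have bdd_below: "bdd_below (above v)" if "v \<in> nonneg_orthant" for v
    using sum_nonneg[OF that] by (intro bdd_belowI[of _ 0]) (auto simp: above_def)
  have bdd_above: "bdd_above (below v)" if v: "v \<in> nonneg_orthant" for v
  proof -
    \<comment> \<open>On the orthant the coordinate sum bounds every coordinate of \<open>v\<close>,
      so it can serve as the radius for bornology.\<close>
    let ?\<epsilon> = "\<Sum>i\<in>UNIV. v $ i"
    obtain \<delta> where "\<delta> \<ge> 0"
      and \<delta>: "\<And>x y. \<lbrakk>x \<in> ?P; y \<in> ?P; max_dist X x y \<le> ?\<epsilon>\<rbrakk> \<Longrightarrow> mdist D x y \<le> \<delta>"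
      using born sum_nonneg[OF v] unfolding bornologous_def id_apply mspace_max_metric mdist_max_metric by metis
    have "max_dist X x y \<le> ?\<epsilon>" if "distance_vector X x y \<le> v" for x y
      unfolding max_dist_le_iff
    proof
      fix i
      have "mdist (X i) (x i) (y i) \<le> v $ i"
        using that by (auto simp: less_eq_vec_def)
      also have "\<dots> \<le> ?\<epsilon>"
        using v by (intro member_le_sum) (auto simp: nonneg_orthant_def)
      finally show "mdist (X i) (x i) (y i) \<le> ?\<epsilon>" .
    qed
    with \<delta> \<open>\<delta> \<ge> 0\<close> show ?thesis by (intro bdd_aboveI[of _ \<delta>]) (auto simp: below_def)
  qed
  have nonneg: "0 \<le> \<Phi> v" if "v \<in> nonneg_orthant" for v
  proof -
    have "0 \<le> Sup (below v)"
      using bdd_above[OF that] by (intro cSup_upper) (auto simp: below_def)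
    then show ?thesis by (simp add: \<Phi>_def)
  qed
  have mono: "\<Phi> u \<le> \<Phi> v" if u: "u \<in> nonneg_orthant" and v: "v \<in> nonneg_orthant" and "u \<le> v" for u v
  proof -
    have "below u \<subseteq> below v" using \<open>u \<le> v\<close> unfolding below_def by (blast intro: order_trans)
    then have "Sup (below u) \<le> Sup (below v)"
      using bdd_above[OF v] by (intro cSup_subset_mono) (auto simp: below_def)
    moreover have "Inf (above u) \<le> Inf (above v)"
    proof (rule cInf_mono)
      show "above v \<noteq> {}" by (simp add: above_def)
      show "bdd_below (above u)" using u by (rule bdd_below)
      have "(\<Sum>i\<in>UNIV. u $ i) \<le> (\<Sum>i\<in>UNIV. v $ i)"
        using \<open>u \<le> v\<close> by (intro sum_mono) (auto simp: less_eq_vec_def)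
      \<comment> \<open>A value of \<open>D\<close> in \<open>above v\<close> already lies in
        \<open>above u\<close> by transitivity; the sum for \<open>v\<close> is matched by the sum
        for \<open>u\<close>.\<close>
      then show "\<exists>a\<in>above u. a \<le> b" if "b \<in> above v" for b
        using that \<open>u \<le> v\<close> unfolding above_def by (fastforce dest: order_trans[OF \<open>u \<le> v\<close>])
    qed
    ultimately show ?thesis unfolding \<Phi>_def by (rule max.mono)
  qed
  have eq: "mdist D x y = \<Phi> (distance_vector X x y)" if xy: "x \<in> ?P" "y \<in> ?P" for x y
  proof -
    let ?v = "distance_vector X x y"
    have "Sup (below ?v) = mdist D x y"
      using xy incr unfolding distance_increasing_def
      by (intro cSup_eq_maximum) (auto simp: below_def)
    moreover have "Inf (above ?v) \<le> mdist D x y"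
      using xy bdd_below[OF distance_vector_in_nonneg_orthant]
      by (intro cInf_lower) (auto simp: above_def)
    ultimately show ?thesis by (simp add: \<Phi>_def)
  qed
  have zero: "(0::real ^ 'n) \<in> nonneg_orthant" by (simp add: nonneg_orthant_def)
  have "\<Phi> 0 = 0"
  proof -
    have "mdist D x y = 0" if "x \<in> ?P" "y \<in> ?P" "distance_vector X x y \<le> 0" for x y
      using distance_vector_le_0_imp_eq[OF that] that D by simp
    \<comment> \<open>Only pairs of equal points have a distance vector below 0.\<close>
    then have "below 0 = {0}" by (auto simp: below_def)
    moreover have "Inf (above 0) \<le> 0"
      using bdd_below[OF zero] by (intro cInf_lower) (auto simp: above_def)
    ultimately show ?thesis by (simp add: \<Phi>_def)
  qed
  moreover have "0 < \<Phi> v" if v: "v \<in> nonneg_orthant" and "v \<noteq> 0" for v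
  proof -
    obtain i where "v $ i \<noteq> 0" using \<open>v \<noteq> 0\<close> by (auto simp: vec_eq_iff)
    with v have pos: "0 < v $ i" by (auto simp: nonneg_orthant_def less_le)
    \<comment> \<open>Uniform continuity is used in contrapositive form: a pair whose distance
      vector lies above \<open>v\<close> has \<open>max_dist\<close> at least \<open>v $ i\<close>,
      hence \<open>D\<close>-distance at least \<delta>. With the positive coordinate sum, this
      bounds \<open>above v\<close> away from 0.\<close>
    obtain \<delta> where "\<delta> > 0"
      and \<delta>: "\<And>x y. \<lbrakk>x \<in> ?P; y \<in> ?P; mdist D x y < \<delta>\<rbrakk> \<Longrightarrow> max_dist X x y < v $ i"
      using unif pos D unfolding uniformly_continuous_map_def D id_apply mdist_max_metric by metis
    have "\<delta> \<le> mdist D x y" if "x \<in> ?P" "y \<in> ?P" "v \<le> distance_vector X x y" for x y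
    proof -
      have "v $ i \<le> mdist (X i) (x i) (y i)"
        using that(3) by (auto simp: less_eq_vec_def)
      then show ?thesis using \<delta>[OF that(1,2)] by (meson max_dist_less_iff not_less)
    qed
    then have "min \<delta> (\<Sum>i\<in>UNIV. v $ i) \<le> Inf (above v)"
      by (intro cInf_greatest) (auto simp: above_def min_le_iff_disj)
    moreover have "v $ i \<le> (\<Sum>i\<in>UNIV. v $ i)"
      using v by (intro member_le_sum) (auto simp: nonneg_orthant_def)
    ultimately show ?thesis using \<open>\<delta> > 0\<close> pos by (auto simp: \<Phi>_def)
  qed
  ultimately have "amenable_on nonneg_orthant \<Phi>"
    using zero nonneg by (auto simp: amenable_on_def)
  moreover have "isotone_on nonneg_orthant \<Phi>"
    using nonneg mono by (auto simp: isotone_on_def intro!: mono_onI)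
  ultimately show ?thesis
    using eq unfolding has_isotone_amenable_continuation_def by blast
qed

theorem theorem3p8:
  fixes X :: "'n::finite \<Rightarrow> 'a metric"
    and D :: "('n \<Rightarrow> 'a) metric"
  assumes "mspace D = product_space X"
  shows "(isotone_metric_product X D \<and> has_isotone_amenable_continuation X D) \<longleftrightarrow>
    (distance_increasing X D \<and>
     bornologous (max_metric X) D id \<and>
     uniformly_continuous_map D (max_metric X) id)"
  using isotone_metric_product_if_continuation[of X D]
    continuation_imp_conditions[OF assms] conditions_imp_continuation[OF assms] by blast

end
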